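(* In the setting described in the context, let $u(\omega)\in V$ be the solution of $A(\omega;u(\omega),v)=F(\omega;v)$ for all $v\in V$, and let $\{U_n^h(\omega)\}_{n\ge0}\subset V^h_r$ be the sequence generated by the discrete iterative algorithm. Then $$\|u(\omega)-U_n^h(\omega)\|_V\le C\bigl(h^\ell+\rho^{n+1}\bigr)\qquad\text{for all }\omega\in\Omega,$$ where $C=C(\omega)>0$ is a constant independent of $h$ and $n$ and $\ell\le r$ is the positive integer order of the finite element Galerkin error estimate given in the context.
   Context: Let $H$ be a (real) Hilbert space, $V\subset H$ a (real) Banach space, and $V^*$ the dual space of bounded linear functionals on $V$. Let $\Omega$ be a set (the parameter space). For each $\omega\in\Omega$, let $F(\omega;\cdot)\in V^*$ and let $A(\omega;\cdot,\cdot):V\times V\to\mathbb{R}$ be a bilinear form (not necessarily symmetric). Assume there are constants $\Lambda>0$ and $\lambda>0$, independent of $\omega$, such that $|A(\omega;v,w)|\le\Lambda\|v\|_V\|w\|_V$ for all $v,w\in V$ and $A(\omega;v,v)\ge\lambda\|v\|_V^2$ for all $v\in V$. Assume also that there is an $\omega$-independent constant $C_F>0$ with $\|F(\omega)\|_{V^*}\le C_F$ for all $\omega\in\Omega$. By the Lax-Milgram theorem the problem $A(\omega;u,v)=F(\omega;v)$ for all $v\in V$ has a unique solution $u(\omega)\in V$. Let $A_0(\cdot,\cdot):V\times V\to\mathbb{R}$ be an $\omega$-independent bilinear form, and set $A_1(\omega;\cdot,\cdot)=A(\omega;\cdot,\cdot)-A_0(\cdot,\cdot)$. Assume that there are constants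 $\Lambda_0,\lambda_0>0$ with $|A_0(v,w)|\le\Lambda_0\|v\|_V\|w\|_V$ for all $v,w\in V$ and $A_0(v,v)\ge\lambda_0\|v\|_V^2$ for all $v\in V$, and that there is $\rho\in(0,1)$ such that $\|A_1(\omega)\|_{\mathcal{L}(V\times V,\mathbb{R})}/\lambda_0<\rho$ for all $\omega\in\Omega$. Here the norm of a bounded bilinear form $B$ is $\|B\|_{\mathcal{L}(V\times V,\mathbb{R})}=\sup\{|B(v,w)|:\|v\|_V\le1,\ \|w\|_V\le1\}$. Finite element spaces: $V$ is a space of functions on a bounded domain $D\subset\mathbb{R}^d$ ($d=1,2,3$), $\mathcal{T}_h$ is a quasi-uniform triangulation of $D$ with mesh size $h\in(0,1)$, and $V^h_r$ ($r\ge1$) is the finite element space of continuous piecewise $r$th order polynomials associated with $\mathcal{T}_h$. It is assumed that $V^h_r$ is a subspace of $V$ (which implicitly assumes $V\subset W^{1,1}(D)$ but $V\not\subset W^{2,1}(D)$). The discrete problem $A(\omega;u_h,v_h)=F(\omega;v_h)$ for all $v_h\in V^h_r$ has a unique solution $u_h(\omega)\in V^h_r$. Standing finite element Galerkin error estimate (taken as given): there are a positive integer $\ell\le r$ and, for each $\omega\in\Omega$, a constant $C'(\omega)>0$ independent of $h$, such that $\|u(\omega)-u_h(\omega)\|_V\le C'(\omega)\,h^\ell$ for all $\omega\in\Omega$. Discrete iterative algorithm: for each $\omega\in\Omega$, $U_0^h=U_0^h(\omega)\in V^h_r$ is defined by $A_0(U_0^h,v_h)=F(\omega;v_h)$ for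 all $v_h\in V^h_r$, and, for $n\ge1$, $U_n^h=U_n^h(\omega)\in V^h_r$ is defined recursively by $A_0(U_n^h,v_h)=F(\omega;v_h)-A_1(\omega;U_{n-1}^h,v_h)$ for all $v_h\in V^h_r$. *)

theory Defs
  imports "HOL-Analysis.Analysis"
begin

section \<open>Bilinear forms\<close>

text \<open>Meaningful for bounded bilinear forms only; otherwise the supremum is unspecified.\<close>
definition bilin_norm :: "('v::real_normed_vector \<Rightarrow> 'v \<Rightarrow> real) \<Rightarrow> real" where
  "bilin_norm B = Sup {\<bar>B v w\<bar> |v w. norm v \<le> 1 \<and> norm w \<le> 1}"

definition bounded_form :: "('v::real_normed_vector \<Rightarrow> 'v \<Rightarrow> real) \<Rightarrow> real \<Rightarrow> bool" where
  "bounded_form B M \<longleftrightarrow> (\<forall>v w. \<bar>B v w\<bar> \<le> M * norm v * norm w)"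

definition coercive_form :: "('v::real_normed_vector \<Rightarrow> 'v \<Rightarrow> real) \<Rightarrow> real \<Rightarrow> bool" where
  "coercive_form B m \<longleftrightarrow> (\<forall>v. B v v \<ge> m * (norm v)\<^sup>2)"

section \<open>Weak derivatives and the spaces \<open>W\<^sup>k\<^sup>,\<^sup>1(D)\<close>\<close>

definition partial_deriv :: "'d \<Rightarrow> (real^'d \<Rightarrow> real) \<Rightarrow> real^'d::finite \<Rightarrow> real" where
  "partial_deriv i f x = frechet_derivative f (at x) (axis i 1)"

primrec Ck :: "nat \<Rightarrow> (real^'d::finite \<Rightarrow> real) \<Rightarrow> bool" where
  "Ck 0 f \<longleftrightarrow> continuous_on UNIV f"
| "Ck (Suc k) f \<longleftrightarrow> f differentiable_on UNIV \<and> (\<forall>i. Ck k (partial_deriv i f))"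

definition test_function :: "(real^'d::finite) set \<Rightarrow> (real^'d \<Rightarrow> real) \<Rightarrow> bool" where
  "test_function D \<phi> \<longleftrightarrow> (\<forall>k. Ck k \<phi>) \<and>
     compact (closure {x. \<phi> x \<noteq> 0}) \<and> closure {x. \<phi> x \<noteq> 0} \<subseteq> D"

definition weak_partial ::
    "(real^'d::finite) set \<Rightarrow> 'd \<Rightarrow> (real^'d \<Rightarrow> real) \<Rightarrow> (real^'d \<Rightarrow> real) \<Rightarrow> bool" where
  "weak_partial D i f g \<longleftrightarrow> (\<forall>\<phi>. test_function D \<phi> \<longrightarrow>
     (\<integral>x. f x * partial_deriv i \<phi> x \<partial>lebesgue_on D) = - (\<integral>x. g x * \<phi> x \<partial>lebesgue_on D))"

text \<open>The recursion encodes \<open>W\<^sup>k\<^sup>+\<^sup>1\<^sup>,\<^sup>1(D) = {f \<in> L\<^sup>1(D). every weak partial derivative of f exists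
  and lies in W\<^sup>k\<^sup>,\<^sup>1(D)}\<close>. Membership does not change under modification on null sets.\<close>
primrec sobolev_W1 :: "nat \<Rightarrow> (real^'d::finite) set \<Rightarrow> (real^'d \<Rightarrow> real) \<Rightarrow> bool" where
  "sobolev_W1 0 D f \<longleftrightarrow> integrable (lebesgue_on D) f"
| "sobolev_W1 (Suc k) D f \<longleftrightarrow> integrable (lebesgue_on D) f \<and>
     (\<forall>i. \<exists>g. weak_partial D i f g \<and> sobolev_W1 k D g)"

section \<open>Triangulations and finite element spaces\<close>

text \<open>\<^const>\<open>triangulation\<close> already demands finitely many simplices that meet face to face.\<close>
definition triangulation_of :: "(real^'d::finite) set \<Rightarrow> (real^'d) set set \<Rightarrow> bool" where
  "triangulation_of D \<T> \<longleftrightarrow> triangulation \<T> \<and>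
     (\<forall>K\<in>\<T>. int CARD('d) simplex K) \<and> \<Union>\<T> = closure D"

definition mesh_size :: "(real^'d::finite) set set \<Rightarrow> real" where
  "mesh_size \<T> = Max (diameter ` \<T>)"

text \<open>\<open>T h\<close> is the triangulation of mesh size \<open>h\<close>, for \<open>h\<close> in the set \<open>S\<close> of mesh sizes used.
  Quasi-uniform: every cell contains a ball of radius at least a fixed multiple of the mesh size.\<close>
definition quasi_uniform_family ::
    "(real^'d::finite) set \<Rightarrow> real set \<Rightarrow> (real \<Rightarrow> (real^'d) set set) \<Rightarrow> bool" where
  "quasi_uniform_family D S T \<longleftrightarrow>
     (\<forall>h\<in>S. triangulation_of D (T h) \<and> mesh_size (T h) = h) \<and>
     (\<exists>\<kappa>>0. \<forall>h\<in>S. \<forall>K\<in>T h. \<exists>x. cball x (\<kappa> * h) \<subseteq> K)"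

text \<open>Polynomials in \<open>d\<close> variables of total degree at most \<open>r\<close>; \<open>\<alpha>\<close> ranges over multi-indices.\<close>
definition poly_deg_le :: "nat \<Rightarrow> (real^'d::finite \<Rightarrow> real) set" where
  "poly_deg_le r =
     {p. \<exists>c. p = (\<lambda>x. \<Sum>\<alpha> | (\<Sum>i\<in>UNIV. \<alpha> i) \<le> r. c \<alpha> * (\<Prod>i\<in>UNIV. (x $ i) ^ \<alpha> i))}"

definition fe_functions :: "nat \<Rightarrow> (real^'d::finite) set set \<Rightarrow> (real^'d \<Rightarrow> real) set" where
  "fe_functions r \<T> = {g. continuous_on (\<Union>\<T>) g \<and>
     (\<forall>K\<in>\<T>. \<exists>p\<in>poly_deg_le r. \<forall>x\<in>K. g x = p x)}"

section \<open>A Banach space of functions on \<open>D\<close>\<close>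

text \<open>\<open>rep v\<close> is a representative of \<open>v\<close>, which as a function on \<open>D\<close> is determined only almost
  everywhere; hence linearity and injectivity are required modulo null sets.\<close>
definition function_space_on ::
    "(real^'d::finite) set \<Rightarrow> ('v::real_vector \<Rightarrow> real^'d \<Rightarrow> real) \<Rightarrow> bool" where
  "function_space_on D rep \<longleftrightarrow>
     (\<forall>v w. AE x in lebesgue_on D. rep (v + w) x = rep v x + rep w x) \<and>
     (\<forall>a v. AE x in lebesgue_on D. rep (a *\<^sub>R v) x = a * rep v x) \<and>
     (\<forall>v. (AE x in lebesgue_on D. rep v x = 0) \<longrightarrow> v = 0)"

definition represents ::
    "(real^'d::finite) set \<Rightarrow> ('v \<Rightarrow> real^'d \<Rightarrow> real) \<Rightarrow> 'v \<Rightarrow> (real^'d \<Rightarrow> real) \<Rightarrow> bool" where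
  "represents D rep v g \<longleftrightarrow> (AE x in lebesgue_on D. rep v x = g x)"

text \<open>The finite element space as a subset of the Banach space. It consists of \<^emph>\<open>all\<close> continuous
  piecewise polynomials only if each of them is represented by some \<open>v\<close>; this is
  \<open>fe_contained\<close>.\<close>
definition fe_space :: "(real^'d::finite) set \<Rightarrow> ('v \<Rightarrow> real^'d \<Rightarrow> real) \<Rightarrow> nat \<Rightarrow>
    (real^'d) set set \<Rightarrow> 'v set" where
  "fe_space D rep r \<T> = {v. \<exists>g\<in>fe_functions r \<T>. represents D rep v g}"

definition fe_contained :: "(real^'d::finite) set \<Rightarrow> ('v \<Rightarrow> real^'d \<Rightarrow> real) \<Rightarrow> nat \<Rightarrow>
    (real^'d) set set \<Rightarrow> bool" where
  "fe_contained D rep r \<T> \<longleftrightarrow> (\<forall>g\<in>fe_functions r \<T>. \<exists>v. represents D rep v g)"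

end

theory Submission
  imports Defs
begin

text \<open>On the finite element space the errors \<open>e\<^sub>n = u\<^sub>h - U\<^sub>n\<close> satisfy
  \<open>A\<^sub>0(e\<^sub>n, v) = - A\<^sub>1(e\<^sub>n\<^sub>-\<^sub>1, v)\<close>, where \<open>e\<^sub>-\<^sub>1 = u\<^sub>h\<close>. Since the space is closed under
  subtraction, \<open>v = e\<^sub>n\<close> is admissible, and coercivity of \<open>A\<^sub>0\<close> makes the iteration a contraction
  by the factor \<open>\<rho>\<close>. Hence \<open>\<parallel>e\<^sub>n\<parallel> \<le> \<rho>\<^sup>n\<^sup>+\<^sup>1 \<parallel>u\<^sub>h\<parallel> \<le> \<rho>\<^sup>n\<^sup>+\<^sup>1 C\<^sub>F / \<lambda>\<close>, which is combined with the
  Galerkin estimate by the triangle inequality.\<close>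

lemma bounded_form_diff:
  assumes "bounded_form B M" "bounded_form B' M'"
  shows "bounded_form (\<lambda>v w. B v w - B' v w) (M + M')"
  unfolding bounded_form_def
proof (intro allI)
  fix v w
  have "\<bar>B v w - B' v w\<bar> \<le> \<bar>B v w\<bar> + \<bar>B' v w\<bar>"
    by simp
  also have "\<dots> \<le> M * norm v * norm w + M' * norm v * norm w"
    using assms by (intro add_mono) (auto simp: bounded_form_def)
  finally show "\<bar>B v w - B' v w\<bar> \<le> (M + M') * norm v * norm w"
    by (simp add: algebra_simps)
qed

lemma bilinear_diff_forms:
  fixes B B' :: "'a::real_vector \<Rightarrow> 'b::real_vector \<Rightarrow> real"
  assumes "bilinear B" "bilinear B'"
  shows "bilinear (\<lambda>v w. B v w - B' v w)"
  using assms by (auto simp: bilinear_def intro!: linear_compose_sub)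

text \<open>Boundedness by \<open>M\<close> makes the set under the supremum bounded above, so
  \<open>bilin_norm B\<close> really is an upper bound on unit vectors. Scaling both arguments to
  norm one carries this bound to all nonzero vectors.\<close>

lemma bounded_form_bilin_norm:
  fixes B :: "'v::real_normed_vector \<Rightarrow> 'v \<Rightarrow> real"
  assumes bil: "bilinear B" and bnd: "bounded_form B M"
  shows "bounded_form B (bilin_norm B)"
  unfolding bounded_form_def
proof (intro allI)
  fix v w :: 'v
  let ?X = "{\<bar>B v w\<bar> |v w. norm v \<le> 1 \<and> norm w \<le> 1}"
  have bdd: "bdd_above ?X"
  \<comment> \<open>The sign of \<open>M\<close> is not known, so the product of norms can be
    replaced by 1 only after passing to the absolute value.\<close>
  proof (rule bdd_aboveI[where M = "\<bar>M\<bar>"])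
    fix x assume "x \<in> ?X"
    then obtain a b where ab: "x = \<bar>B a b\<bar>" "norm a \<le> 1" "norm b \<le> 1"
      by blast
    have "\<bar>B a b\<bar> \<le> M * (norm a * norm b)"
      using bnd by (simp add: bounded_form_def mult.assoc)
    also have "\<dots> \<le> \<bar>M\<bar> * (norm a * norm b)"
      by (intro mult_right_mono) auto
    also have "\<dots> \<le> \<bar>M\<bar> * 1"
      using ab by (intro mult_left_mono mult_le_one) auto
    finally show "x \<le> \<bar>M\<bar>"
      using ab by simp
  qed
  show "\<bar>B v w\<bar> \<le> bilin_norm B * norm v * norm w"
  proof (cases "v = 0 \<or> w = 0")
    case True
    then show ?thesis
      using bilinear_lzero[OF bil] bilinear_rzero[OF bil] by auto
  next
    case False
    have "\<bar>B (v /\<^sub>R norm v) (w /\<^sub>R norm w)\<bar> \<le> bilin_norm B"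
      unfolding bilin_norm_def
    proof (rule cSup_upper[OF _ bdd])
      have "norm (v /\<^sub>R norm v) \<le> 1" "norm (w /\<^sub>R norm w) \<le> 1"
        using False by auto
      then show "\<bar>B (v /\<^sub>R norm v) (w /\<^sub>R norm w)\<bar> \<in> ?X"
        by blast
    qed
    moreover have "B (v /\<^sub>R norm v) (w /\<^sub>R norm w) = B v w / (norm v * norm w)"
      by (simp only: bilinear_lmul[OF bil] bilinear_rmul[OF bil]) (simp add: divide_inverse)
    ultimately have "\<bar>B v w\<bar> / (norm v * norm w) \<le> bilin_norm B"
      by (simp add: abs_mult)
    then show ?thesis
      using False by (simp add: pos_divide_le_eq mult.assoc)
  qed
qed

text \<open>Coercivity is quadratic in \<open>norm v\<close> and the upper bound linear, so one
  factor cancels. For \<open>v = 0\<close> nothing can be cancelled, and \<open>c \<ge> 0\<close>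
  gives the claim.\<close>

lemma coercive_form_norm_le:
  assumes "coercive_form B m" "m > 0" "B v v \<le> c * norm v" "c \<ge> 0"
  shows "norm v \<le> c / m"
proof (cases "v = 0")
  case True
  then show ?thesis
    using assms by simp
next
  case False
  have "m * (norm v)\<^sup>2 \<le> c * norm v"
    using assms unfolding coercive_form_def by (meson order_trans)
  then have "(m * norm v) * norm v \<le> c * norm v"
    by (simp add: power2_eq_square algebra_simps)
  then have "m * norm v \<le> c"
    using False by simp
  then show ?thesis
    using assms(2) by (simp add: field_simps)
qed

text \<open>With \<open>e\<close> as its own test vector, \<open>m * (norm e)\<^sup>2\<close> is at
  most \<open>M * norm e' * norm e\<close>, and \<open>M \<le> \<rho> * m\<close>. The equation is
  required at \<open>e\<close> alone, so no subspace has to be mentioned.\<close>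

lemma coercive_contraction:
  assumes "coercive_form B\<^sub>0 m" "m > 0" "bounded_form B\<^sub>1 M" "M / m \<le> \<rho>" "0 \<le> \<rho>"
    and eq: "B\<^sub>0 e e = - B\<^sub>1 e' e"
  shows "norm e \<le> \<rho> * norm e'"
proof -
  have "B\<^sub>0 e e \<le> M * norm e' * norm e"
    using assms(3) eq unfolding bounded_form_def by (smt (verit))
  also have "\<dots> \<le> (\<rho> * m) * norm e' * norm e"
    using assms by (intro mult_right_mono) (auto simp: field_simps)
  finally have "norm e \<le> (\<rho> * m * norm e') / m"
    using assms(2,5) by (intro coercive_form_norm_le[OF assms(1,2)]) auto
  then show ?thesis
    using assms(2) by simp
qed

lemma poly_deg_le_diff:
  assumes "p \<in> poly_deg_le r" "q \<in> poly_deg_le r"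
  shows "(\<lambda>x. p x - q x) \<in> poly_deg_le r"
proof -
  obtain c c' where
    "p = (\<lambda>x. \<Sum>\<alpha> | (\<Sum>i\<in>UNIV. \<alpha> i) \<le> r. c \<alpha> * (\<Prod>i\<in>UNIV. (x $ i) ^ \<alpha> i))"
    "q = (\<lambda>x. \<Sum>\<alpha> | (\<Sum>i\<in>UNIV. \<alpha> i) \<le> r. c' \<alpha> * (\<Prod>i\<in>UNIV. (x $ i) ^ \<alpha> i))"
    using assms unfolding poly_deg_le_def by blast
  then show ?thesis
    unfolding poly_deg_le_def
    by (auto simp: sum_subtractf left_diff_distrib intro!: exI[of _ "\<lambda>\<alpha>. c \<alpha> - c' \<alpha>"])
qed

lemma fe_functions_diff:
  assumes "f \<in> fe_functions r \<T>" "g \<in> fe_functions r \<T>"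
  shows "(\<lambda>x. f x - g x) \<in> fe_functions r \<T>"
  unfolding fe_functions_def
proof (intro CollectI conjI ballI)
  show "continuous_on (\<Union>\<T>) (\<lambda>x. f x - g x)"
    using assms by (auto simp: fe_functions_def intro: continuous_on_diff)
next
  fix K assume "K \<in> \<T>"
  then obtain p q where pq: "p \<in> poly_deg_le r" "q \<in> poly_deg_le r"
    "\<forall>x\<in>K. f x = p x" "\<forall>x\<in>K. g x = q x"
    using assms unfolding fe_functions_def by blast
  then show "\<exists>s\<in>poly_deg_le r. \<forall>x\<in>K. f x - g x = s x"
    by (intro bexI[OF _ poly_deg_le_diff[OF pq(1,2)]]) auto
qed

text \<open>Linearity of \<open>rep\<close> is given almost everywhere, for sums and scalar
  multiples. Hence the difference is read as \<open>v + (-1) *\<^sub>R w\<close>, and the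
  exceptional null sets are merged.\<close>

lemma represents_diff:
  assumes "function_space_on D rep" "represents D rep v f" "represents D rep w g"
  shows "represents D rep (v - w) (\<lambda>x. f x - g x)"
proof -
  have "AE x in lebesgue_on D. rep (v + (-1) *\<^sub>R w) x = rep v x + rep ((-1) *\<^sub>R w) x"
    "AE x in lebesgue_on D. rep ((-1) *\<^sub>R w) x = (-1) * rep w x"
    using assms(1) unfolding function_space_on_def by blast+
  with assms(2,3) show ?thesis
    unfolding represents_def by eventually_elim simp
qed

text \<open>This makes the discrete errors admissible as test functions.\<close>

lemma fe_space_diff:
  assumes "function_space_on D rep" "v \<in> fe_space D rep r \<T>" "w \<in> fe_space D rep r \<T>"
  shows "v - w \<in> fe_space D rep r \<T>"
  using assms represents_diff fe_functions_diff unfolding fe_space_def by blast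

theorem theorem4p3:
  fixes J :: "'v::banach \<Rightarrow> 'h::{real_inner, complete_space}"
    and D :: "(real^'d::finite) set"
    and rep :: "'v \<Rightarrow> real^'d \<Rightarrow> real"
    and \<Omega> :: "'w set"
    and F :: "'w \<Rightarrow> ('v \<Rightarrow>\<^sub>L real)"
    and A A\<^sub>1 :: "'w \<Rightarrow> 'v \<Rightarrow> 'v \<Rightarrow> real"
    and A\<^sub>0 :: "'v \<Rightarrow> 'v \<Rightarrow> real"
    and \<Lambda> lam \<Lambda>\<^sub>0 lam\<^sub>0 C\<^sub>F \<rho> :: real
    and S :: "real set"
    and T :: "real \<Rightarrow> (real^'d) set set"
    and r l :: nat
    and u :: "'w \<Rightarrow> 'v"
    and u\<^sub>h :: "real \<Rightarrow> 'w \<Rightarrow> 'v"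
    and U :: "real \<Rightarrow> nat \<Rightarrow> 'w \<Rightarrow> 'v"
  assumes V_in_H: "linear J" "inj J"
    and A_bilinear: "\<And>\<omega>. \<omega> \<in> \<Omega> \<Longrightarrow> bilinear (A \<omega>)"
    and const_pos: "\<Lambda> > 0" "lam > 0"
    and A_bounded: "\<And>\<omega>. \<omega> \<in> \<Omega> \<Longrightarrow> bounded_form (A \<omega>) \<Lambda>"
    and A_coercive: "\<And>\<omega>. \<omega> \<in> \<Omega> \<Longrightarrow> coercive_form (A \<omega>) lam"
    and F_bounded: "C\<^sub>F > 0" "\<And>\<omega>. \<omega> \<in> \<Omega> \<Longrightarrow> norm (F \<omega>) \<le> C\<^sub>F"
    and A0_bilinear: "bilinear A\<^sub>0"
    and const0_pos: "\<Lambda>\<^sub>0 > 0" "lam\<^sub>0 > 0"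
    and A0_bounded: "bounded_form A\<^sub>0 \<Lambda>\<^sub>0"
    and A0_coercive: "coercive_form A\<^sub>0 lam\<^sub>0"
    and A1: "\<And>\<omega> v w. A\<^sub>1 \<omega> v w = A \<omega> v w - A\<^sub>0 v w"
    and rho: "0 < \<rho>" "\<rho> < 1"
    and A1_small: "\<And>\<omega>. \<omega> \<in> \<Omega> \<Longrightarrow> bilin_norm (A\<^sub>1 \<omega>) / lam\<^sub>0 < \<rho>"
    and dimension: "CARD('d) \<in> {1, 2, 3}"
    and domain: "open D" "connected D" "D \<noteq> {}" "bounded D"
    and V_functions: "function_space_on D rep"
    and V_W11: "\<And>v. sobolev_W1 1 D (rep v)"
    and V_not_W21: "\<exists>v. \<not> sobolev_W1 2 D (rep v)"
    and meshes: "S \<subseteq> {0<..<1}" "quasi_uniform_family D S T"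
    and degree: "r \<ge> 1"
    and Vh_in_V: "\<And>h. h \<in> S \<Longrightarrow> fe_contained D rep r (T h)"
    and u_sol: "\<And>\<omega> v. \<omega> \<in> \<Omega> \<Longrightarrow> A \<omega> (u \<omega>) v = F \<omega> v"
    and uh_in: "\<And>h \<omega>. h \<in> S \<Longrightarrow> \<omega> \<in> \<Omega> \<Longrightarrow> u\<^sub>h h \<omega> \<in> fe_space D rep r (T h)"
    and uh_sol: "\<And>h \<omega> v. h \<in> S \<Longrightarrow> \<omega> \<in> \<Omega> \<Longrightarrow> v \<in> fe_space D rep r (T h) \<Longrightarrow>
                   A \<omega> (u\<^sub>h h \<omega>) v = F \<omega> v"
    and order: "0 < l" "l \<le> r"
    and galerkin_estimate: "\<And>\<omega>. \<omega> \<in> \<Omega> \<Longrightarrow>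
                   \<exists>C'>0. \<forall>h\<in>S. norm (u \<omega> - u\<^sub>h h \<omega>) \<le> C' * h ^ l"
    and U_in: "\<And>h n \<omega>. h \<in> S \<Longrightarrow> \<omega> \<in> \<Omega> \<Longrightarrow> U h n \<omega> \<in> fe_space D rep r (T h)"
    and U_0: "\<And>h \<omega> v. h \<in> S \<Longrightarrow> \<omega> \<in> \<Omega> \<Longrightarrow> v \<in> fe_space D rep r (T h) \<Longrightarrow>
                   A\<^sub>0 (U h 0 \<omega>) v = F \<omega> v"
    and U_n: "\<And>h n \<omega> v. h \<in> S \<Longrightarrow> \<omega> \<in> \<Omega> \<Longrightarrow> n \<ge> 1 \<Longrightarrow> v \<in> fe_space D rep r (T h) \<Longrightarrow>
                   A\<^sub>0 (U h n \<omega>) v = F \<omega> v - A\<^sub>1 \<omega> (U h (n - 1) \<omega>) v"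
  shows "\<forall>\<omega>\<in>\<Omega>. \<exists>C>0. \<forall>h\<in>S. \<forall>n. norm (u \<omega> - U h n \<omega>) \<le> C * (h ^ l + \<rho> ^ (n + 1))"
proof
  fix \<omega> assume \<omega>: "\<omega> \<in> \<Omega>"
  obtain C' where C': "C' > 0" "\<And>h. h \<in> S \<Longrightarrow> norm (u \<omega> - u\<^sub>h h \<omega>) \<le> C' * h ^ l"
    using galerkin_estimate[OF \<omega>] by blast
  have A1_eq: "A\<^sub>1 \<omega> = (\<lambda>v w. A \<omega> v w - A\<^sub>0 v w)"
    by (simp add: fun_eq_iff A1)
  have A1_bil: "bilinear (A\<^sub>1 \<omega>)"
    unfolding A1_eq by (rule bilinear_diff_forms[OF A_bilinear[OF \<omega>] A0_bilinear])
  \<comment> \<open>The crude bound \<open>\<Lambda> + \<Lambda>\<^sub>0\<close> is traded for the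
    operator norm, the quantity that \<open>A1_small\<close> compares with
    \<open>lam\<^sub>0\<close>.\<close>
  have A1_bnd: "bounded_form (A\<^sub>1 \<omega>) (bilin_norm (A\<^sub>1 \<omega>))"
    using bounded_form_diff[OF A_bounded[OF \<omega>] A0_bounded]
    by (intro bounded_form_bilin_norm[OF A1_bil]) (simp add: A1_eq)
  \<comment> \<open>\<open>C'\<close> serves the Galerkin error and \<open>C\<^sub>F / lam\<close>
    the size of the discrete solution. The choice precedes \<open>h\<close> and \<open>n\<close>,
    hence is independent of both.\<close>
  define C where "C = max C' (C\<^sub>F / lam)"
  have "norm (u \<omega> - U h n \<omega>) \<le> C * (h ^ l + \<rho> ^ (n + 1))" if h: "h \<in> S" for h n
  proof -
    let ?W = "fe_space D rep r (T h)"
    let ?e = "\<lambda>n. u\<^sub>h h \<omega> - U h n \<omega>"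
    have e_in: "?e n \<in> ?W" for n
      by (rule fe_space_diff[OF V_functions uh_in[OF h \<omega>] U_in[OF h \<omega>]])
    \<comment> \<open>The vector \<open>e'\<close> stays free: it is the discrete solution at the
      start of the iteration and the preceding error afterwards.\<close>
    have contr: "norm (?e n) \<le> \<rho> * norm e'" if "A\<^sub>0 (?e n) (?e n) = - A\<^sub>1 \<omega> e' (?e n)" for n e'
      using A1_small[OF \<omega>] rho that
      by (intro coercive_contraction[OF A0_coercive const0_pos(2) A1_bnd]) auto
    have uh_eq: "A \<omega> (u\<^sub>h h \<omega>) v = F \<omega> v" if "v \<in> ?W" for v
      by (rule uh_sol[OF h \<omega> that])
    \<comment> \<open>The exponent is \<open>n + 1\<close> because the start
      \<open>U h 0 \<omega>\<close> is itself one iteration step from zero and already gains a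
      factor \<open>\<rho>\<close>.\<close>
    have e_bound: "norm (?e n) \<le> \<rho> ^ (n + 1) * norm (u\<^sub>h h \<omega>)" for n
    proof (induction n)
      case 0
      have "A\<^sub>0 (?e 0) (?e 0) = - A\<^sub>1 \<omega> (u\<^sub>h h \<omega>) (?e 0)"
        using uh_eq[OF e_in] U_0[OF h \<omega> e_in]
        by (simp only: bilinear_lsub[OF A0_bilinear] A1)
      from contr[OF this] show ?case
        by simp
    next
      case (Suc n)
      have "A\<^sub>0 (U h (Suc n) \<omega>) (?e (Suc n))
          = F \<omega> (?e (Suc n)) - A\<^sub>1 \<omega> (U h n \<omega>) (?e (Suc n))"
        using U_n[OF h \<omega> _ e_in, of "Suc n"] by simp
      \<comment> \<open>Splitting \<open>A \<omega>\<close> into \<open>A\<^sub>0\<close> plus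
        \<open>A\<^sub>1 \<omega>\<close> shows that the discrete solution is a fixed point of the
        iteration. Subtracting the two equations cancels \<open>F \<omega>\<close>.\<close>
      then have "A\<^sub>0 (?e (Suc n)) (?e (Suc n)) = - A\<^sub>1 \<omega> (?e n) (?e (Suc n))"
        using uh_eq[OF e_in, of "Suc n"] A1[of \<omega> "u\<^sub>h h \<omega>" "?e (Suc n)"]
          bilinear_lsub[OF A0_bilinear, of "u\<^sub>h h \<omega>" "U h (Suc n) \<omega>" "?e (Suc n)"]
          bilinear_lsub[OF A1_bil, of "u\<^sub>h h \<omega>" "U h n \<omega>" "?e (Suc n)"]
        by linarith
      from contr[OF this] have "norm (?e (Suc n)) \<le> \<rho> * norm (?e n)" .
      also have "\<dots> \<le> \<rho> * (\<rho> ^ (n + 1) * norm (u\<^sub>h h \<omega>))"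
        using Suc.IH rho by (intro mult_left_mono) auto
      finally show ?case
        by (simp add: mult.assoc)
    qed
    \<comment> \<open>Stability uniform in \<open>h\<close>: the discrete equation is tested with
      its own solution.\<close>
    have "norm (u\<^sub>h h \<omega>) \<le> C\<^sub>F / lam"
    proof (rule coercive_form_norm_le[OF A_coercive[OF \<omega>] const_pos(2)])
      have "A \<omega> (u\<^sub>h h \<omega>) (u\<^sub>h h \<omega>) \<le> norm (F \<omega>) * norm (u\<^sub>h h \<omega>)"
        using norm_blinfun[of "F \<omega>" "u\<^sub>h h \<omega>"] uh_eq[OF uh_in[OF h \<omega>]] by simp
      also have "\<dots> \<le> C\<^sub>F * norm (u\<^sub>h h \<omega>)"
        using F_bounded(2)[OF \<omega>] by (intro mult_right_mono) auto
      finally show "A \<omega> (u\<^sub>h h \<omega>) (u\<^sub>h h \<omega>) \<le> C\<^sub>F * norm (u\<^sub>h h \<omega>)" .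
    qed (use F_bounded(1) in simp)
    then have uh_le: "norm (u\<^sub>h h \<omega>) \<le> C"
      by (simp add: C_def)
    have "norm (u \<omega> - U h n \<omega>) \<le> norm (u \<omega> - u\<^sub>h h \<omega>) + norm (?e n)"
      using norm_triangle_ineq[of "u \<omega> - u\<^sub>h h \<omega>" "?e n"] by simp
    also have "\<dots> \<le> C' * h ^ l + \<rho> ^ (n + 1) * norm (u\<^sub>h h \<omega>)"
      by (rule add_mono[OF C'(2)[OF h] e_bound])
    \<comment> \<open>Mesh sizes are positive, so \<open>h ^ l\<close> is nonnegative and
      \<open>C'\<close> may be enlarged to \<open>C\<close>.\<close>
    also have "\<dots> \<le> C * h ^ l + \<rho> ^ (n + 1) * C"
      using uh_le rho meshes(1) h
      by (intro add_mono mult_left_mono mult_right_mono) (auto simp: C_def)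
    finally show ?thesis
      by (simp add: algebra_simps)
  qed
  moreover have "C > 0"
    using C'(1) by (simp add: C_def)
  ultimately show "\<exists>C>0. \<forall>h\<in>S. \<forall>n. norm (u \<omega> - U h n \<omega>) \<le> C * (h ^ l + \<rho> ^ (n + 1))"
    by blast
qed

end
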